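(* Let $n\ge 2$, $\delta \in (0,n/(n-1))$, $A = \delta I + (1-\delta)\mathbf{1}\mathbf{1}^T \in \mathbb{R}^{n\times n}$, $f(x) = \frac12 x^TAx$, and $x^0\in\mathbb{R}^n$. Let $x^{\ell n}$ be the iterate after $\ell$ epochs of RPCD with exact line search started from $x^0$, and let $(\eta_\ell,\nu_\ell)$ be the sequence defined in the context. Then for every integer $\ell\ge 0$, \[ \mathbb{E}_{P_1,P_2,\dots,P_\ell}\, f(x^{\ell n}) = \frac12\left( \eta_\ell \|x^0\|^2 + \nu_\ell (\mathbf{1}^Tx^0)^2\right) \le \left\| \begin{pmatrix} \eta_\ell \\ \nu_\ell \end{pmatrix} \right\| \max\left( \|x^0\|^2, (\mathbf{1}^Tx^0)^2 \right). \]
   Context: $\mathbf{1} = (1,1,\dots,1)^T \in \mathbb{R}^n$, $\|\cdot\|$ is the Euclidean norm, $\|\cdot\|_F$ the Frobenius norm. The matrix $A$ has unit diagonal and satisfies $P^TAP=A$ for every permutation matrix $P$. RPCD (random-permutations cyclic coordinate descent) with exact line search: at the start of each epoch $\ell = 0,1,2,\dots$ a permutation $\pi_{\ell+1}$ of $\{1,\dots,n\}$ is drawn uniformly at random, independently of the previous ones. Epoch $\ell$ consists of the $n$ iterations $k=\ell n+j$, $j=0,\dots,n-1$, where, with $i$ the $(j+1)$th entry of $\pi_{\ell+1}$, $x^{k+1} = x^k - (Ax^k)_i e_i$, $e_i$ being the $i$th standard basis vector. Writing $P_l$ for the permutation matrix representing $\pi_l$, \[ x^{\ell n} = P_\ell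 C P_\ell^T\, P_{\ell-1} C P_{\ell-1}^T \cdots P_1 C P_1^T\, x^0, \] where $C = -(L+D)^{-1}L^T$ and $A = L+D+L^T$ with $L$ strictly lower triangular and $D=I$ the diagonal of $A$. The expectation is over the independent uniformly random $P_1,\dots,P_\ell$. Define \[ d_2 = \frac{\|C\mathbf{1}\|^2 - \|C\|_F^2}{n(n-1)},\quad d_1 = \frac{\|C\|_F^2}{n} - d_2,\quad m_2 = \frac{(\mathbf{1}^TC\mathbf{1})^2 - \|C^T\mathbf{1}\|^2}{n(n-1)},\quad m_1 = \frac{\|C^T\mathbf{1}\|^2}{n} - m_2, \] \[ M = \begin{pmatrix} d_1 & m_1 \\ d_2 & m_2 \end{pmatrix}, \qquad \begin{pmatrix}\eta_\ell \\ \nu_\ell\end{pmatrix} = M^\ell \begin{pmatrix} \delta \\ 1-\delta\end{pmatrix},\quad \ell \ge 0 . \] *)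

theory Defs
  imports "HOL-Analysis.Analysis" "HOL-Probability.Probability"
    "HOL-Combinatorics.Multiset_Permutations"
begin

text \<open>
  The coordinates \<open>1, \<dots>, n\<close> are rendered as a finite linearly ordered index type \<open>'n\<close>
  with \<open>CARD('n) = n\<close>; the order is needed only to speak of triangular matrices.
  The vector of all ones is \<open>1 :: real^'n\<close>, and the norm on \<open>real^'n\<close> is Euclidean.
  The norm of a matrix as an element of \<open>real^'n^'n\<close> is its Frobenius norm (it is the
  Euclidean norm of the vector of row norms).  Products and powers of matrices must be written
  with \<open>**\<close>, since \<open>*\<close> and \<open>^\<close> are componentwise on \<open>real^'n^'n\<close>.
\<close>

definition outer_prod :: "real^'n \<Rightarrow> real^'n \<Rightarrow> real^'n^'n" where
  "outer_prod u v = (\<chi> i j. u $ i * v $ j)"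

definition quad_form :: "real^'n^'n \<Rightarrow> real^'n \<Rightarrow> real" where
  "quad_form A x = 1 / 2 * (x \<bullet> (A *v x))"

definition strict_lower ::
  "real^'n::{finite,linorder}^'n::{finite,linorder}
     \<Rightarrow> real^'n::{finite,linorder}^'n::{finite,linorder}"
where
  "strict_lower A = (\<chi> i j. if j < i then A $ i $ j else 0)"

definition diag_part :: "real^'n^'n \<Rightarrow> real^'n^'n" where
  "diag_part A = (\<chi> i j. if i = j then A $ i $ j else 0)"

definition epoch_matrix ::
  "real^'n::{finite,linorder}^'n::{finite,linorder}
     \<Rightarrow> real^'n::{finite,linorder}^'n::{finite,linorder}"
where
  "epoch_matrix A =
     - (matrix_inv (strict_lower A + diag_part A) ** transpose (strict_lower A))"

text \<open>
  \<open>\<pi> l\<close> is the permutation used in epoch \<open>l - 1\<close> (for \<open>l \<ge> 1\<close>), as the list of its entries.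
  The step along coordinate \<open>i\<close> has length \<open>(A x)\<^sub>i\<close>, which is the exact line search for
  matrices with unit diagonal.
\<close>

primrec rpcd_iterate ::
  "real^'n^'n \<Rightarrow> (nat \<Rightarrow> 'n list) \<Rightarrow> real^'n \<Rightarrow> nat \<Rightarrow> real^'n"
where
  "rpcd_iterate A \<pi> x0 0 = x0"
| "rpcd_iterate A \<pi> x0 (Suc k) =
     (let x = rpcd_iterate A \<pi> x0 k;
          i = \<pi> (k div CARD('n) + 1) ! (k mod CARD('n))
      in x - (A *v x) $ i *\<^sub>R axis i 1)"

text \<open>
  The first \<open>l\<close> permutations, independent and uniform.  Only \<open>\<pi> 1, \<dots>, \<pi> l\<close> are random; the
  value \<open>[]\<close> elsewhere is a dummy.
\<close>

definition random_perms :: "nat \<Rightarrow> (nat \<Rightarrow> 'n::finite list) pmf" where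
  "random_perms l = Pi_pmf {1..l} [] (\<lambda>_. pmf_of_set (permutations_of_set (UNIV :: 'n set)))"

definition coeff_d2 :: "real^'n^'n \<Rightarrow> real" where
  "coeff_d2 C = ((norm (C *v 1))\<^sup>2 - (norm C)\<^sup>2) / (real CARD('n) * (real CARD('n) - 1))"

definition coeff_d1 :: "real^'n^'n \<Rightarrow> real" where
  "coeff_d1 C = (norm C)\<^sup>2 / real CARD('n) - coeff_d2 C"

definition coeff_m2 :: "real^'n^'n \<Rightarrow> real" where
  "coeff_m2 C = ((1 \<bullet> (C *v 1))\<^sup>2 - (norm (transpose C *v 1))\<^sup>2)
                  / (real CARD('n) * (real CARD('n) - 1))"

definition coeff_m1 :: "real^'n^'n \<Rightarrow> real" where
  "coeff_m1 C = (norm (transpose C *v 1))\<^sup>2 / real CARD('n) - coeff_m2 C"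

definition recurrence_matrix :: "real^'n^'n \<Rightarrow> real^2^2" where
  "recurrence_matrix C = vector [vector [coeff_d1 C, coeff_m1 C], vector [coeff_d2 C, coeff_m2 C]]"

text \<open>The vector \<open>(\<eta>\<^sub>l, \<nu>\<^sub>l)\<close>, obtained by applying the recurrence matrix \<open>l\<close> times.\<close>

definition eta_nu :: "real^'n^'n \<Rightarrow> real \<Rightarrow> nat \<Rightarrow> real^2" where
  "eta_nu C \<delta> l = (((*v) (recurrence_matrix C)) ^^ l) (vector [\<delta>, 1 - \<delta>])"

end

theory Submission
  imports Defs
begin

text \<open>
  By the permutation invariance of \<open>A\<close>, an epoch along a permutation \<open>p\<close> is the conjugate by \<open>p\<close>
  of a Gauss--Seidel sweep in the natural order, which is multiplication by the epoch matrix.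
  Averaging a quadratic form \<open>Q\<close> over all relabellings of the coordinates only keeps the average
  of its diagonal and of its off-diagonal entries, so the span of
  \<open>\<parallel>x\<parallel>\<^sup>2\<close> and \<open>(1\<^sup>T x)\<^sup>2\<close> is preserved by averaging over one epoch, which acts on it by the
  recurrence matrix.  The objective lies in this span, and independence of the epochs gives the
  claim by induction.
\<close>

section \<open>Averages over permutations\<close>

lemma ex_permutation_of_two_points:
  assumes "a \<noteq> b" "c \<noteq> d"
  obtains p where "p permutes UNIV" "p a = c" "p b = d"
proof
  \<comment> \<open>The inner transposition moves \<open>a\<close> to \<open>c\<close> and
    \<open>b\<close> to a point other than \<open>c\<close>; the outer one moves that point to
    \<open>d\<close> and fixes \<open>c\<close>.\<close>
  let ?p = "Transposition.transpose (Transposition.transpose a c b) d \<circ> Transposition.transpose a c"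
  show "?p permutes UNIV"
    by (intro permutes_compose permutes_swap_id) auto
  show "?p a = c" "?p b = d"
    using assms by (auto simp: Transposition.transpose_def)
qed

text \<open>Right translation by \<open>s\<close> is a bijection of the symmetric group.\<close>

lemma sum_permutes_two_points:
  fixes f :: "'a::finite \<Rightarrow> 'a \<Rightarrow> 'b::comm_monoid_add"
  assumes "s permutes UNIV"
  shows "(\<Sum>p | p permutes UNIV. f (p (s a)) (p (s b))) = (\<Sum>p | p permutes UNIV. f (p a) (p b))"
  by (rule sum.reindex_bij_witness[of _ "\<lambda>p. p \<circ> inv s" "\<lambda>p. p \<circ> s"])
    (use assms in \<open>auto intro: permutes_compose permutes_inv simp: permutes_inverses fun_eq_iff\<close>)

lemma sum_all_pairs:
  fixes f :: "'a::finite \<Rightarrow> 'a \<Rightarrow> real"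
  shows "(\<Sum>i\<in>UNIV. \<Sum>j\<in>UNIV. f i j) = (\<Sum>i\<in>UNIV. f i i) + (\<Sum>i\<in>UNIV. \<Sum>j\<in>-{i}. f i j)"
proof -
  have "(\<Sum>j\<in>UNIV. f i j) = f i i + (\<Sum>j\<in>-{i}. f i j)" for i
    using sum.remove[of UNIV i "f i"] by (simp add: Compl_eq_Diff_UNIV)
  then show ?thesis by (simp add: sum.distrib)
qed

text \<open>Translating by a transposition shows that the sum over \<open>p\<close> does not depend
  on \<open>a\<close>. Summing over all points as well and exchanging the sums leaves the same sum
  of squares for every \<open>p\<close>.\<close>

lemma sum_permutes_power2:
  fixes x :: "'a::finite \<Rightarrow> real"
  shows "real CARD('a) * (\<Sum>p | p permutes UNIV. x (p a) * x (p a)) =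
    fact CARD('a) * (\<Sum>i\<in>UNIV. (x i)\<^sup>2)"
proof -
  have *: "(\<Sum>p | p permutes UNIV. x (p b) * x (p b)) = (\<Sum>p | p permutes UNIV. x (p a) * x (p a))"
    for b
    using sum_permutes_two_points[OF permutes_swap_id[of a UNIV b], of "\<lambda>i j. x i * x j" a a] by simp
  have "real CARD('a) * (\<Sum>p | p permutes UNIV. x (p a) * x (p a)) =
      (\<Sum>b\<in>UNIV. \<Sum>p | p permutes UNIV. x (p b) * x (p b))"
    by (simp add: sum.cong[OF refl *])
  also have "\<dots> = (\<Sum>p | p permutes (UNIV::'a set). \<Sum>b\<in>UNIV. x (p b) * x (p b))"
    by (rule sum.swap)
  also have "\<dots> = (\<Sum>p | p permutes (UNIV::'a set). \<Sum>b\<in>UNIV. x b * x b)"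
    by (intro sum.cong refl sum.permute[symmetric, unfolded comp_def]) auto
  also have "\<dots> = fact CARD('a) * (\<Sum>i\<in>UNIV. (x i)\<^sup>2)"
    by (simp add: card_permutations power2_eq_square)
  finally show ?thesis .
qed

text \<open>The symmetric group is doubly transitive, so all n(n-1) ordered pairs of distinct points
  give the same sum. Their total is the sum over all pairs minus the diagonal.\<close>

lemma sum_permutes_mult_distinct:
  fixes x :: "'a::finite \<Rightarrow> real"
  assumes "a \<noteq> b"
  shows "real CARD('a) * (real CARD('a) - 1) * (\<Sum>p | p permutes UNIV. x (p a) * x (p b)) =
    fact CARD('a) * ((\<Sum>i\<in>UNIV. x i)\<^sup>2 - (\<Sum>i\<in>UNIV. (x i)\<^sup>2))"
proof -
  let ?F = "\<lambda>a b. \<Sum>p | p permutes UNIV. x (p a) * x (p b)"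
  have eq: "?F c d = ?F a b" if cd: "c \<noteq> d" for c d
  proof -
    obtain s where "s permutes UNIV" "s a = c" "s b = d"
      by (rule ex_permutation_of_two_points[OF assms cd])
    then show ?thesis
      using sum_permutes_two_points[of s "\<lambda>i j. x i * x j" a b] by simp
  qed
  have "real CARD('a) * (real CARD('a) - 1) * ?F a b = (\<Sum>c\<in>UNIV. \<Sum>d\<in>-{c}. ?F c d)"
  proof -
    have "(\<Sum>d\<in>-{c}. ?F c d) = (real CARD('a) - 1) * ?F a b" for c
    proof -
      have "(\<Sum>d\<in>-{c}. ?F c d) = (\<Sum>d\<in>-{c}. ?F a b)"
        by (intro sum.cong refl eq) auto
      then show ?thesis
        by (simp add: Compl_eq_Diff_UNIV card_Diff_singleton of_nat_diff Suc_leI)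
    qed
    then show ?thesis by simp
  qed
  also have "\<dots> = (\<Sum>c\<in>UNIV. \<Sum>d\<in>UNIV. ?F c d) - (\<Sum>c\<in>UNIV. ?F c c)"
    by (simp add: sum_all_pairs[of ?F])
  also have "(\<Sum>c\<in>UNIV. ?F c c) = fact CARD('a) * (\<Sum>i\<in>UNIV. (x i)\<^sup>2)"
  proof -
    have "?F c c = fact CARD('a) * (\<Sum>i\<in>UNIV. (x i)\<^sup>2) / CARD('a)" for c
      using sum_permutes_power2[of x c] by (simp add: eq_divide_eq mult.commute)
    then show ?thesis by simp
  qed
  also have "(\<Sum>c\<in>UNIV. \<Sum>d\<in>UNIV. ?F c d) =
      (\<Sum>p | p permutes UNIV. (\<Sum>c\<in>UNIV. x (p c)) * (\<Sum>d\<in>UNIV. x (p d)))"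
    by (simp add: sum_product sum.swap[of _ _ "{p. p permutes UNIV}"])
  also have "\<dots> = (\<Sum>p | p permutes (UNIV::'a set). (\<Sum>c\<in>UNIV. x c)\<^sup>2)"
    using sum.permute[of _ UNIV x]
    by (intro sum.cong refl) (simp add: power2_eq_square comp_def)
  also have "\<dots> = fact CARD('a) * (\<Sum>c\<in>UNIV. x c)\<^sup>2"
    by (simp add: card_permutations)
  finally show ?thesis by (simp add: algebra_simps)
qed

text \<open>Averaging sees \<open>Q\<close> only through its mean diagonal entry and its mean
  off-diagonal entry \<open>off\<close>; the averaged form has these two as its constant
  entries.\<close>

lemma average_quadratic_form:
  fixes Q :: "'a::finite \<Rightarrow> 'a \<Rightarrow> real" and x :: "'a \<Rightarrow> real"
  assumes "CARD('a) \<ge> 2"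
  defines "off \<equiv> ((\<Sum>a\<in>UNIV. \<Sum>b\<in>UNIV. Q a b) - (\<Sum>a\<in>UNIV. Q a a))
                     / (real CARD('a) * (real CARD('a) - 1))"
  shows "(\<Sum>p | p permutes UNIV. \<Sum>a\<in>UNIV. \<Sum>b\<in>UNIV. Q a b * (x (p a) * x (p b))) / fact CARD('a) =
    ((\<Sum>a\<in>UNIV. Q a a) / real CARD('a) - off) * (\<Sum>i\<in>UNIV. (x i)\<^sup>2) + off * (\<Sum>i\<in>UNIV. x i)\<^sup>2"
proof -
  let ?n = "real CARD('a)" and ?F = "\<lambda>a b. \<Sum>p | p permutes UNIV. x (p a) * x (p b)"
  define N S where "N = (\<Sum>i\<in>UNIV. (x i)\<^sup>2)" and "S = (\<Sum>i\<in>UNIV. x i)\<^sup>2"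
  define t u where "t = (\<Sum>a\<in>UNIV. Q a a)" and "u = (\<Sum>a\<in>UNIV. \<Sum>b\<in>-{a}. Q a b)"
  have n: "?n \<noteq> 0" "?n - 1 \<noteq> 0" using assms(1) by auto
  have diag: "?F a a = fact CARD('a) * (N / ?n)" for a
    using sum_permutes_power2[of x a] n by (simp add: N_def field_simps)
  have offd: "?F a b = fact CARD('a) * ((S - N) / (?n * (?n - 1)))" if "a \<noteq> b" for a b
    using sum_permutes_mult_distinct[OF that, of x] n unfolding N_def S_def
    by (simp add: eq_divide_eq mult_ac)
  have "(\<Sum>p | p permutes UNIV. \<Sum>a\<in>UNIV. \<Sum>b\<in>UNIV. Q a b * (x (p a) * x (p b))) =
      (\<Sum>a\<in>UNIV. \<Sum>b\<in>UNIV. Q a b * ?F a b)"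
    by (simp add: sum.swap[of _ _ "{p. p permutes UNIV}"] sum_distrib_left)
  also have "\<dots> = (\<Sum>a\<in>UNIV. Q a a * ?F a a) + (\<Sum>a\<in>UNIV. \<Sum>b\<in>-{a}. Q a b * ?F a b)"
    by (rule sum_all_pairs)
  also have "(\<Sum>a\<in>UNIV. Q a a * ?F a a) = fact CARD('a) * (t * (N / ?n))"
    unfolding diag t_def sum_distrib_right sum_distrib_left by (simp only: mult_ac)
  also have "(\<Sum>a\<in>UNIV. \<Sum>b\<in>-{a}. Q a b * ?F a b) =
      (\<Sum>a\<in>UNIV. \<Sum>b\<in>-{a}. Q a b * (fact CARD('a) * ((S - N) / (?n * (?n - 1)))))"
    by (intro sum.cong refl arg_cong2[where f="(*)"] offd) auto
  also have "\<dots> = fact CARD('a) * (u * ((S - N) / (?n * (?n - 1))))"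
    unfolding u_def sum_distrib_right sum_distrib_left by (simp only: mult_ac)
  finally have "(\<Sum>p | p permutes UNIV. \<Sum>a\<in>UNIV. \<Sum>b\<in>UNIV. Q a b * (x (p a) * x (p b))) =
      fact CARD('a) * (t * (N / ?n) + u * ((S - N) / (?n * (?n - 1))))"
    by (simp only: distrib_left)
  moreover have "off = u / (?n * (?n - 1))"
    by (simp add: off_def u_def sum_all_pairs[of Q])
  ultimately show ?thesis
    unfolding t_def[symmetric] N_def[symmetric] S_def[symmetric]
    by (simp add: left_diff_distrib right_diff_distrib diff_divide_distrib)
qed

text \<open>A uniformly random order is a uniformly random relabelling of one fixed order
  \<open>xs\<close>; this turns expectations over lists into the averages above.\<close>

lemma map_pmf_of_set_permutes:
  assumes "distinct xs" "set xs = (UNIV :: 'a::finite set)"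
  shows "map_pmf (\<lambda>p. map p xs) (pmf_of_set {p. p permutes (UNIV :: 'a set)}) =
    pmf_of_set (permutations_of_set UNIV)"
proof (rule map_pmf_of_set_bij_betw)
  show "bij_betw (\<lambda>p. map p xs) {p. p permutes UNIV} (permutations_of_set UNIV)"
    unfolding bij_betw_def
  proof
    show inj: "inj_on (\<lambda>p. map p xs) {p. p permutes UNIV}"
      using assms by (auto simp: inj_on_def)
    have "(\<lambda>p. map p xs) ` {p. p permutes UNIV} \<subseteq> permutations_of_set UNIV"
      using assms by (auto simp: permutations_of_set_def distinct_map permutes_inj_on permutes_image
          simp del: set_map) (metis UNIV_I image_set permutes_image)+
    \<comment> \<open>Surjectivity follows from injectivity, since both sides have n!
      elements.\<close>
    moreover have "card ((\<lambda>p. map p xs) ` {p. p permutes UNIV}) = card (permutations_of_set (UNIV :: 'a set))"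
      by (subst card_image[OF inj]) (simp add: card_permutations)
    ultimately show "(\<lambda>p. map p xs) ` {p. p permutes UNIV} = permutations_of_set UNIV"
      by (intro card_subset_eq) auto
  qed
  show "{p. p permutes (UNIV :: 'a set)} \<noteq> {}"
    using permutes_id by blast
qed auto

section \<open>Epochs of coordinate descent\<close>

text \<open>Separated from \<open>rpcd_iterate\<close> so that an epoch becomes a
  \<open>fold\<close> over its list of coordinates.\<close>

definition cd_step :: "real^'n^'n \<Rightarrow> 'n \<Rightarrow> real^'n \<Rightarrow> real^'n" where
  "cd_step A i x = x - (A *v x) $ i *\<^sub>R axis i 1"

lemma cd_step_nth: "cd_step A i x $ j = (if j = i then x $ i - (A *v x) $ i else x $ j)"
  by (simp add: cd_step_def axis_def)

lemma rpcd_iterate_within_epoch: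
  fixes A :: "real^'n^'n"
  assumes "k \<le> CARD('n)" "length (\<pi> (Suc l)) = CARD('n)"
  shows "rpcd_iterate A \<pi> x0 (l * CARD('n) + k) =
    fold (cd_step A) (take k (\<pi> (Suc l))) (rpcd_iterate A \<pi> x0 (l * CARD('n)))"
  using assms(1)
proof (induction k)
  case (Suc k)
  \<comment> \<open>Epochs count from 0 but permutations from 1, so quotient \<open>l\<close>
    selects \<open>\<pi> (Suc l)\<close>.\<close>
  then have "(l * CARD('n) + k) div CARD('n) = l" "(l * CARD('n) + k) mod CARD('n) = k"
    by auto
  then show ?case
    using Suc assms(2) by (simp add: Let_def take_Suc_conv_app_nth cd_step_def)
qed simp

text \<open>The first \<open>l\<close> epochs read only the permutations 1 to \<open>l\<close>, so
  the next permutation can be overwritten without changing earlier iterates.\<close>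

lemma rpcd_iterate_cong:
  fixes A :: "real^'n^'n"
  assumes "\<And>j. j \<in> {1..l} \<Longrightarrow> \<pi> j = \<pi>' j" "k \<le> l * CARD('n)"
  shows "rpcd_iterate A \<pi> x0 k = rpcd_iterate A \<pi>' x0 k"
  using assms(2)
proof (induction k)
  case (Suc k)
  then have "k div CARD('n) < l"
    by (simp add: less_mult_imp_div_less)
  then show ?case
    using Suc assms(1)[of "k div CARD('n) + 1"] by (simp add: Let_def)
qed simp

lemma rpcd_iterate_epoch:
  fixes A :: "real^'n^'n"
  assumes "length ys = CARD('n)"
  shows "rpcd_iterate A (\<pi>(Suc l := ys)) x0 (Suc l * CARD('n)) =
    fold (cd_step A) ys (rpcd_iterate A \<pi> x0 (l * CARD('n)))"
proof -
  have "rpcd_iterate A (\<pi>(Suc l := ys)) x0 (l * CARD('n)) = rpcd_iterate A \<pi> x0 (l * CARD('n))"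
    by (rule rpcd_iterate_cong[where l = l]) auto
  then show ?thesis
    using rpcd_iterate_within_epoch[of "CARD('n)" "\<pi>(Suc l := ys)" l A x0] assms
    by (simp add: add.commute)
qed

text \<open>This is the Gauss-Seidel formula: when an increasing sweep reaches \<open>i\<close>, the
  smaller coordinates have their final values and the larger ones their initial values. The list may
  be a proper part of the index set so that induction can append a largest element
  \<open>k\<close>.\<close>

lemma sweep_sorted_nth:
  fixes A :: "real^'n::{finite,linorder}^'n::{finite,linorder}" and x
  assumes "sorted_wrt (<) xs" "\<And>i. A $ i $ i = 1"
  defines "y \<equiv> fold (cd_step A) xs x"
  shows "y $ i = (if i \<in> set xs
      then - (\<Sum>j | j < i. A $ i $ j * y $ j) - (\<Sum>j | i < j. A $ i $ j * x $ j) else x $ i)"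
  using assms(1) unfolding y_def
proof (induction xs arbitrary: i rule: rev_induct)
  case (snoc k xs)
  let ?z = "fold (cd_step A) xs x"
  have less: "j < k" if "j \<in> set xs" for j
    using snoc.prems that by (simp add: sorted_wrt_append)
  have z: "?z $ i = (if i \<in> set xs
      then - (\<Sum>j | j < i. A $ i $ j * ?z $ j) - (\<Sum>j | i < j. A $ i $ j * x $ j) else x $ i)" for i
    using snoc by (simp add: sorted_wrt_append)
  have below: "(\<Sum>j | j < i. A $ i $ j * cd_step A k ?z $ j) = (\<Sum>j | j < i. A $ i $ j * ?z $ j)"
    if "i \<le> k" for i
    using that by (intro sum.cong) (auto simp: cd_step_nth)
  have above: "?z $ j = x $ j" if "k \<le> j" for j
    using that less z[of j] by (auto dest: leD)
  \<comment> \<open>Splitting row \<open>k\<close> isolates its diagonal term \<open>?z $ k\<close>,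
    which the step at \<open>k\<close> cancels.\<close>
  have split: "(UNIV :: 'n set) = insert k ({j. j < k} \<union> {j. k < j})" by auto
  have disj: "{j. j < k} \<inter> {j. k < j} = {}" by auto
  have "(A *v ?z) $ k = (\<Sum>j\<in>insert k ({j. j < k} \<union> {j. k < j}). A $ k $ j * ?z $ j)"
    by (simp only: matrix_vector_mult_def vec_lambda_beta flip: split)
  also have "\<dots> = ?z $ k + (\<Sum>j | j < k. A $ k $ j * ?z $ j) + (\<Sum>j | k < j. A $ k $ j * ?z $ j)"
    by (simp add: sum.union_disjoint disj assms(2))
  also have "(\<Sum>j | k < j. A $ k $ j * ?z $ j) = (\<Sum>j | k < j. A $ k $ j * x $ j)"
    by (intro sum.cong) (auto simp: above)
  finally have "cd_step A k ?z $ k =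
      - (\<Sum>j | j < k. A $ k $ j * ?z $ j) - (\<Sum>j | k < j. A $ k $ j * x $ j)"
    by (simp add: cd_step_nth)
  then show ?case
    using below[of i] z[of i] less[of i] by (auto simp: cd_step_nth)
qed simp

text \<open>Forward substitution shows that the kernel is trivial, and a square matrix with trivial
  kernel is invertible.\<close>

lemma unit_lower_triangular_invertible:
  fixes A :: "real^'n::{finite,linorder}^'n::{finite,linorder}"
  assumes "\<And>i. A $ i $ i = 1"
  shows "invertible (strict_lower A + diag_part A)"
proof -
  let ?T = "strict_lower A + diag_part A"
  have "x = 0" if "?T *v x = 0" for x
  proof -
    have "x $ i = 0" for i
    \<comment> \<open>The number of smaller indices serves as the position of \<open>i\<close> in
      the finite order.\<close>
    proof (induction "card {j. j < i}" arbitrary: i rule: less_induct)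
      case less
      have zero: "x $ j = 0" if "j < i" for j
      proof -
        have "{k. k < j} \<subset> {k. k < i}" using that by auto
        then show ?thesis by (intro less psubset_card_mono) auto
      qed
      have "0 = (\<Sum>j\<in>UNIV. ?T $ i $ j * x $ j)"
        using arg_cong[OF \<open>?T *v x = 0\<close>, of "\<lambda>v. v $ i"] by (simp add: matrix_vector_mult_def)
      also have "\<dots> = (\<Sum>j\<in>UNIV. if j = i then x $ i else 0)"
        by (intro sum.cong refl) (auto simp: strict_lower_def diag_part_def assms zero)
      finally show ?case by simp
    qed
    then show ?thesis by (simp add: vec_eq_iff)
  qed
  then show ?thesis
    by (metis matrix_left_invertible_ker invertible_left_inverse)
qed

text \<open>With every coordinate visited, the Gauss-Seidel formula says that the result y solves (L
  + D) y = -L^T x.\<close>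

lemma epoch_matrix_eq_sweep:
  fixes A :: "real^'n::{finite,linorder}^'n::{finite,linorder}"
  assumes diag: "\<And>i. A $ i $ i = 1" and sym: "\<And>i j. A $ i $ j = A $ j $ i"
    and xs: "sorted_wrt (<) xs" "set xs = UNIV"
  shows "epoch_matrix A *v x = fold (cd_step A) xs x"
proof -
  let ?T = "strict_lower A + diag_part A" and ?U = "transpose (strict_lower A)"
  let ?y = "fold (cd_step A) xs x"
  have "(?T *v ?y) $ i = (- (?U *v x)) $ i" for i
  proof -
    have "(?T *v ?y) $ i = (\<Sum>j\<in>UNIV. (if j < i then A $ i $ j * ?y $ j else 0) + (if j = i then ?y $ i else 0))"
      unfolding matrix_vector_mult_def
      by (auto intro!: sum.cong simp: strict_lower_def diag_part_def diag)
    also have "\<dots> = (\<Sum>j | j < i. A $ i $ j * ?y $ j) + ?y $ i"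
      by (simp add: sum.distrib sum.If_cases Collect_conj_eq)
    also have "\<dots> = - (\<Sum>j | i < j. A $ i $ j * x $ j)"
      using sweep_sorted_nth[OF xs(1) diag, of x i] xs(2) by simp
    also have "(\<Sum>j | i < j. A $ i $ j * x $ j) = (\<Sum>j\<in>UNIV. if i < j then A $ i $ j * x $ j else 0)"
      by (simp add: sum.If_cases)
    also have "\<dots> = (?U *v x) $ i"
      unfolding matrix_vector_mult_def
      \<comment> \<open>Symmetry identifies the part of \<open>A\<close> above the diagonal with
        L^T.\<close>
      by (auto intro!: sum.cong simp: strict_lower_def transpose_def sym[of i])
    finally show ?thesis by simp
  qed
  then have eq: "?T *v ?y = - (?U *v x)" by (simp add: vec_eq_iff)
  have neg: "(- M) *v z = - (M *v z)" for M :: "real^'n::{finite,linorder}^'n::{finite,linorder}" and z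
    by (simp add: vec_eq_iff matrix_vector_mult_def sum_negf)
  have "matrix_inv ?T ** ?T = mat 1"
    using someI_ex[OF unit_lower_triangular_invertible[OF diag, unfolded invertible_def]]
    by (simp add: matrix_inv_def)
  then have "?y = matrix_inv ?T *v (?T *v ?y)"
    by (simp add: matrix_vector_mul_assoc)
  also have "\<dots> = epoch_matrix A *v x"
    unfolding eq epoch_matrix_def neg
    by (simp only: linear_neg[OF matrix_vector_mul_linear] matrix_vector_mul_assoc)
  finally show ?thesis by simp
qed

text \<open>Since \<open>p\<close> preserves \<open>A\<close>, pulling vectors back along
  \<open>p\<close> turns the step at \<open>p k\<close> into the step at \<open>k\<close>; the sweep
  follows step by step.\<close>

lemma sweep_relabel:
  fixes A :: "real^'n^'n"
  assumes p: "p permutes UNIV" and inv: "\<And>i j. A $ p i $ p j = A $ i $ j"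
  shows "(\<chi> i. fold (cd_step A) (map p xs) x $ p i) = fold (cd_step A) xs (\<chi> i. x $ p i)"
proof (induction xs arbitrary: x)
  case (Cons k xs)
  have "(A *v x) $ p k = (A *v (\<chi> i. x $ p i)) $ k"
    using sum.permute[OF p, of "\<lambda>j. A $ p k $ j * x $ j"]
    by (simp add: matrix_vector_mult_def comp_def inv)
  then have "(\<chi> i. cd_step A (p k) x $ p i) = cd_step A k (\<chi> i. x $ p i)"
    using permutes_inj[OF p] by (auto simp: vec_eq_iff cd_step_nth inj_eq)
  with Cons show ?case by simp
qed simp

section \<open>The recursion for the expected objective\<close>

text \<open>The vector \<open>v\<close> holds the coordinates of a form in the invariant span, so
  that the recurrence matrix can act on it.\<close>

definition norm_sum_form :: "real^2 \<Rightarrow> real^'n \<Rightarrow> real" where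
  "norm_sum_form v x = v $ 1 * (norm x)\<^sup>2 + v $ 2 * (1 \<bullet> x)\<^sup>2"

lemma power2_norm_vec: "(norm (x :: real^'n))\<^sup>2 = (\<Sum>i\<in>UNIV. (x $ i)\<^sup>2)"
  unfolding power2_norm_eq_inner by (simp add: inner_vec_def power2_eq_square)

lemma power2_norm_matrix:
  "(norm (C :: real^'n^'m))\<^sup>2 = (\<Sum>i\<in>UNIV. \<Sum>j\<in>UNIV. (C $ i $ j)\<^sup>2)"
  unfolding power2_norm_eq_inner by (simp add: inner_vec_def power2_eq_square)

lemma inner_one_vec: "1 \<bullet> (x :: real^'n) = (\<Sum>i\<in>UNIV. x $ i)"
  by (simp add: inner_vec_def)

lemma norm_sum_form_relabel:
  assumes "p permutes UNIV"
  shows "norm_sum_form v (\<chi> i. x $ p i) = norm_sum_form v x"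
  using sum.permute[OF assms, of "\<lambda>i. (x $ i)\<^sup>2"] sum.permute[OF assms, of "\<lambda>i. x $ i"]
  by (simp add: norm_sum_form_def power2_norm_vec inner_one_vec comp_def)

lemma average_norm_sum_form:
  fixes C :: "real^'n^'n"
  assumes "CARD('n) \<ge> 2"
  shows "(\<Sum>p | p permutes UNIV. norm_sum_form v (C *v (\<chi> i. x $ p i))) / fact CARD('n) =
    norm_sum_form (recurrence_matrix C *v v) x"
proof -
  \<comment> \<open>\<open>G\<close> is C^T C, and \<open>H\<close> is the outer square of C^T 1:
    the matrices of the squared norm and of the squared coordinate sum of C y.\<close>
  define G where "G a b = (\<Sum>i\<in>UNIV. C $ i $ a * C $ i $ b)" for a b
  define H where "H a b = (\<Sum>i\<in>UNIV. C $ i $ a) * (\<Sum>i\<in>UNIV. C $ i $ b)" for a b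
  define Q where "Q a b = v $ 1 * G a b + v $ 2 * H a b" for a b
  have form: "norm_sum_form v (C *v y) = (\<Sum>a\<in>UNIV. \<Sum>b\<in>UNIV. Q a b * (y $ a * y $ b))" for y
  proof -
    have "(norm (C *v y))\<^sup>2 = (\<Sum>i\<in>UNIV. \<Sum>a\<in>UNIV. \<Sum>b\<in>UNIV. C $ i $ a * C $ i $ b * (y $ a * y $ b))"
      unfolding power2_norm_vec
      by (simp add: matrix_vector_mult_def power2_eq_square sum_product mult_ac)
    also have "\<dots> = (\<Sum>a\<in>UNIV. \<Sum>i\<in>UNIV. \<Sum>b\<in>UNIV. C $ i $ a * C $ i $ b * (y $ a * y $ b))"
      by (rule sum.swap)
    also have "\<dots> = (\<Sum>a\<in>UNIV. \<Sum>b\<in>UNIV. G a b * (y $ a * y $ b))"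
      unfolding G_def sum_distrib_right by (intro sum.cong refl sum.swap)
    finally have 1: "(norm (C *v y))\<^sup>2 = \<dots>" .
    have "1 \<bullet> (C *v y) = (\<Sum>a\<in>UNIV. (\<Sum>i\<in>UNIV. C $ i $ a) * y $ a)"
      unfolding inner_one_vec matrix_vector_mult_def sum_distrib_right vec_lambda_beta
      by (rule sum.swap)
    then have 2: "(1 \<bullet> (C *v y))\<^sup>2 =
        (\<Sum>a\<in>UNIV. \<Sum>b\<in>UNIV. H a b * (y $ a * y $ b))"
      by (simp only: H_def power2_eq_square sum_product mult_ac)
    show ?thesis
      unfolding norm_sum_form_def 1 2 Q_def
      by (simp add: sum_distrib_left distrib_right sum.distrib mult.assoc)
  qed
  have tr: "(\<Sum>a\<in>UNIV. Q a a) = v $ 1 * (norm C)\<^sup>2 + v $ 2 * (norm (transpose C *v 1))\<^sup>2"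
  proof -
    have "(\<Sum>a\<in>UNIV. G a a) = (norm C)\<^sup>2"
      unfolding G_def power2_norm_matrix unfolding power2_eq_square by (rule sum.swap)
    moreover have "(\<Sum>a\<in>UNIV. H a a) = (norm (transpose C *v 1))\<^sup>2"
      unfolding power2_norm_vec
      by (simp add: H_def matrix_vector_mult_def transpose_def power2_eq_square)
    ultimately show ?thesis
      by (simp add: Q_def sum.distrib flip: sum_distrib_left)
  qed
  \<comment> \<open>The sum of all entries of \<open>Q\<close> is the value of its form at the
    all-ones vector.\<close>
  have tot: "(\<Sum>a\<in>UNIV. \<Sum>b\<in>UNIV. Q a b) = v $ 1 * (norm (C *v 1))\<^sup>2 + v $ 2 * (1 \<bullet> (C *v 1))\<^sup>2"
    using form[of 1] by (simp add: norm_sum_form_def)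
  have "(\<Sum>p | p permutes UNIV. norm_sum_form v (C *v (\<chi> i. x $ p i))) / fact CARD('n) =
    (\<Sum>p | p permutes UNIV. \<Sum>a\<in>UNIV. \<Sum>b\<in>UNIV. Q a b * (x $ p a * x $ p b)) / fact CARD('n)"
    by (simp add: form)
  also have "\<dots> = norm_sum_form (recurrence_matrix C *v v) x"
    unfolding average_quadratic_form[OF assms, of Q "\<lambda>i. x $ i"] tr tot
    by (simp add: norm_sum_form_def power2_norm_vec inner_one_vec recurrence_matrix_def
        matrix_vector_mult_def sum_2 coeff_d1_def coeff_d2_def coeff_m1_def coeff_m2_def
        add_divide_distrib diff_divide_distrib algebra_simps)
  finally show ?thesis .
qed

lemma expectation_epoch:
  fixes A :: "real^'n::{finite,linorder}^'n::{finite,linorder}"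
  assumes "CARD('n) \<ge> 2" "\<And>i. A $ i $ i = 1" "\<And>i j. A $ i $ j = A $ j $ i"
    and "\<And>p i j. p permutes UNIV \<Longrightarrow> A $ p i $ p j = A $ i $ j"
  shows "measure_pmf.expectation (pmf_of_set (permutations_of_set UNIV))
      (\<lambda>ys. norm_sum_form v (fold (cd_step A) ys x)) =
    norm_sum_form (recurrence_matrix (epoch_matrix A) *v v) x"
proof -
  define xs where "xs = sorted_list_of_set (UNIV :: 'n set)"
  have xs: "sorted_wrt (<) xs" "set xs = UNIV" "distinct xs"
    by (auto simp: xs_def)
  have ne: "{p. p permutes (UNIV :: 'n set)} \<noteq> {}"
    using permutes_id by blast
  \<comment> \<open>The form is invariant under relabelling, so the result of the sweep may be
    pulled back along \<open>p\<close>; it is then the sorted sweep applied to the relabelled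
    \<open>x\<close>.\<close>
  have conj: "norm_sum_form v (fold (cd_step A) (map p xs) x) =
      norm_sum_form v (epoch_matrix A *v (\<chi> i. x $ p i))" if "p permutes UNIV" for p
  proof -
    have "norm_sum_form v (fold (cd_step A) (map p xs) x) =
        norm_sum_form v (\<chi> i. fold (cd_step A) (map p xs) x $ p i)"
      using norm_sum_form_relabel[OF that] by simp
    also have "(\<chi> i. fold (cd_step A) (map p xs) x $ p i) = epoch_matrix A *v (\<chi> i. x $ p i)"
      using sweep_relabel[OF that, of A xs x] epoch_matrix_eq_sweep[OF assms(2,3) xs(1,2)] assms(4) that
      by simp
    finally show ?thesis .
  qed
  have "measure_pmf.expectation (pmf_of_set (permutations_of_set UNIV))
      (\<lambda>ys. norm_sum_form v (fold (cd_step A) ys x)) =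
    (\<Sum>p | p permutes UNIV. norm_sum_form v (fold (cd_step A) (map p xs) x)) / fact CARD('n)"
    unfolding map_pmf_of_set_permutes[OF xs(3,2), symmetric]
    by (simp add: integral_pmf_of_set[OF ne] finite_permutations card_permutations)
  also have "\<dots> = (\<Sum>p | p permutes UNIV. norm_sum_form v (epoch_matrix A *v (\<chi> i. x $ p i))) / fact CARD('n)"
    by (simp add: conj)
  finally show ?thesis
    by (simp add: average_norm_sum_form[OF assms(1)])
qed

section \<open>Independence of the epochs\<close>

lemma finite_set_random_perms: "finite (set_pmf (random_perms l))"
  by (simp add: random_perms_def set_Pi_pmf finite_PiE_dflt)

lemma random_perms_Suc:
  "random_perms (Suc l) = random_perms l \<bind>
     (\<lambda>\<pi>. map_pmf (\<lambda>ys. \<pi>(Suc l := ys)) (pmf_of_set (permutations_of_set UNIV)))"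
proof -
  have "{1..Suc l} = insert (Suc l) {1..l}" by auto
  then show ?thesis
    unfolding random_perms_def map_pmf_def
    \<comment> \<open>\<open>Pi_pmf_insert'\<close> draws the new permutation first; independence
      allows drawing it last.\<close>
    by (subst bind_commute_pmf) (simp add: Pi_pmf_insert')
qed

lemma expectation_rpcd_iterate:
  fixes A :: "real^'n::{finite,linorder}^'n::{finite,linorder}"
  assumes "CARD('n) \<ge> 2" "\<And>i. A $ i $ i = 1" "\<And>i j. A $ i $ j = A $ j $ i"
    and "\<And>p i j. p permutes UNIV \<Longrightarrow> A $ p i $ p j = A $ i $ j"
  shows "measure_pmf.expectation (random_perms l)
      (\<lambda>\<pi>. norm_sum_form v (rpcd_iterate A \<pi> x0 (l * CARD('n)))) =
    norm_sum_form ((((*v) (recurrence_matrix (epoch_matrix A))) ^^ l) v) x0"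
\<comment> \<open>Averaging out the last epoch replaces \<open>v\<close> by its image under the
  recurrence matrix, so the induction hypothesis is needed at that image.\<close>
proof (induction l arbitrary: v)
  case 0
  then show ?case by (simp add: random_perms_def)
next
  case (Suc l)
  let ?R = "random_perms l :: (nat \<Rightarrow> 'n list) pmf" and ?U = "permutations_of_set (UNIV :: 'n set)"
  let ?q = "\<lambda>v \<pi> k. norm_sum_form v (rpcd_iterate A \<pi> x0 (k * CARD('n)))"
  \<comment> \<open>This is the conditional expectation over the last epoch, given the first
    \<open>l\<close> permutations.\<close>
  have inner: "measure_pmf.expectation (map_pmf (\<lambda>ys. \<pi>(Suc l := ys)) (pmf_of_set ?U)) (\<lambda>\<pi>. ?q v \<pi> (Suc l)) =
      ?q (recurrence_matrix (epoch_matrix A) *v v) \<pi> l" for \<pi>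
  proof -
    have "measure_pmf.expectation (map_pmf (\<lambda>ys. \<pi>(Suc l := ys)) (pmf_of_set ?U)) (\<lambda>\<pi>. ?q v \<pi> (Suc l)) =
        measure_pmf.expectation (pmf_of_set ?U)
          (\<lambda>ys. norm_sum_form v (fold (cd_step A) ys (rpcd_iterate A \<pi> x0 (l * CARD('n)))))"
      unfolding integral_map_pmf
    proof (intro integral_cong_AE AE_pmfI)
      fix ys assume "ys \<in> set_pmf (pmf_of_set ?U)"
      then have "length ys = CARD('n)"
        by (auto dest: length_finite_permutations_of_set)
      then show "?q v (\<pi>(Suc l := ys)) (Suc l) =
          norm_sum_form v (fold (cd_step A) ys (rpcd_iterate A \<pi> x0 (l * CARD('n))))"
        by (simp only: rpcd_iterate_epoch)
    qed auto
    then show ?thesis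
      using expectation_epoch[OF assms] by simp
  qed
  have "measure_pmf.expectation (random_perms (Suc l)) (\<lambda>\<pi>. ?q v \<pi> (Suc l)) =
      (\<Sum>\<pi>\<in>set_pmf ?R. pmf ?R \<pi> *\<^sub>R ?q (recurrence_matrix (epoch_matrix A) *v v) \<pi> l)"
    unfolding random_perms_Suc
    by (subst pmf_expectation_bind[OF finite_set_random_perms]) (auto simp only: inner, simp_all)
  also have "\<dots> = measure_pmf.expectation ?R (\<lambda>\<pi>. ?q (recurrence_matrix (epoch_matrix A) *v v) \<pi> l)"
    by (rule integral_measure_pmf[symmetric, OF finite_set_random_perms]) auto
  finally show ?case
    \<comment> \<open>The last epoch acts on \<open>v\<close> first, hence the unfolding of the
      power on the right.\<close>
    by (simp only: Suc.IH funpow_Suc_right comp_def)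
qed

text \<open>Places the objective in the invariant span: for \<open>a = \<delta>\<close> and
  \<open>b = 1 - \<delta>\<close> its coordinates are the starting vector of
  \<open>eta_nu\<close>.\<close>

lemma quad_form_scaled_mat_outer_one:
  "quad_form (a *\<^sub>R mat 1 + b *\<^sub>R outer_prod 1 1) x = 1 / 2 * norm_sum_form (vector [a, b]) x"
proof -
  have "outer_prod 1 1 *v x = (1 \<bullet> x) *\<^sub>R 1"
    by (simp add: vec_eq_iff matrix_vector_mult_def outer_prod_def inner_one_vec)
  then have "(a *\<^sub>R mat 1 + b *\<^sub>R outer_prod 1 1) *v x = a *\<^sub>R x + (b * (1 \<bullet> x)) *\<^sub>R 1"
    by (simp add: matrix_vector_mult_add_rdistrib flip: scaleR_matrix_vector_assoc)
  then show ?thesis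
    unfolding quad_form_def norm_sum_form_def power2_norm_eq_inner
    by (simp add: inner_right_distrib inner_commute[of x 1] power2_eq_square)
qed

theorem theorem3p3:
  fixes A :: "real^'n::{finite,linorder}^'n::{finite,linorder}"
    and x0 :: "real^'n::{finite,linorder}"
    and \<delta> :: real
    and l :: nat
  assumes "CARD('n) \<ge> 2"
    and "0 < \<delta>" and "\<delta> < real CARD('n) / (real CARD('n) - 1)"
    and "A = \<delta> *\<^sub>R mat 1 + (1 - \<delta>) *\<^sub>R outer_prod 1 1"
  defines "\<eta> \<equiv> eta_nu (epoch_matrix A) \<delta> l $ 1"
    and "\<nu> \<equiv> eta_nu (epoch_matrix A) \<delta> l $ 2"
  shows "measure_pmf.expectation (random_perms l)
           (\<lambda>\<pi>. quad_form A (rpcd_iterate A \<pi> x0 (l * CARD('n))))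
         = 1 / 2 * (\<eta> * (norm x0)\<^sup>2 + \<nu> * (1 \<bullet> x0)\<^sup>2)
       \<and> 1 / 2 * (\<eta> * (norm x0)\<^sup>2 + \<nu> * (1 \<bullet> x0)\<^sup>2)
         \<le> norm (vector [\<eta>, \<nu>] :: real^2) * max ((norm x0)\<^sup>2) ((1 \<bullet> x0)\<^sup>2)"
proof
  have A: "A $ i $ j = (if i = j then 1 else 1 - \<delta>)" for i j
    by (simp add: assms(4) mat_def outer_prod_def)
  have inv: "A $ p i $ p j = A $ i $ j" if "p permutes UNIV" for p i j
    using permutes_inj[OF that] by (simp add: A inj_eq)
  have "measure_pmf.expectation (random_perms l)
      (\<lambda>\<pi>. quad_form A (rpcd_iterate A \<pi> x0 (l * CARD('n)))) =
    1 / 2 * measure_pmf.expectation (random_perms l)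
      (\<lambda>\<pi>. norm_sum_form (vector [\<delta>, 1 - \<delta>]) (rpcd_iterate A \<pi> x0 (l * CARD('n))))"
    unfolding assms(4) quad_form_scaled_mat_outer_one by simp
  also have "\<dots> = 1 / 2 * norm_sum_form (eta_nu (epoch_matrix A) \<delta> l) x0"
    by (subst expectation_rpcd_iterate[OF assms(1)]) (auto simp: A inv eta_nu_def inj_eq permutes_inj)
  finally show "measure_pmf.expectation (random_perms l)
      (\<lambda>\<pi>. quad_form A (rpcd_iterate A \<pi> x0 (l * CARD('n)))) =
    1 / 2 * (\<eta> * (norm x0)\<^sup>2 + \<nu> * (1 \<bullet> x0)\<^sup>2)"
    by (simp add: norm_sum_form_def \<eta>_def \<nu>_def)
next
  let ?w = "vector [\<eta>, \<nu>] :: real^2" and ?m = "max ((norm x0)\<^sup>2) ((1 \<bullet> x0)\<^sup>2)"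
  have "\<eta> \<le> norm ?w" "\<nu> \<le> norm ?w"
    using component_le_norm_cart[of ?w 1] component_le_norm_cart[of ?w 2] by simp_all
  \<comment> \<open>Monotonicity requires nonnegativity only of the norm and the squares, so
    \<open>\<eta>\<close> and \<open>\<nu>\<close> may have any sign. The factor 1/2 then absorbs
    the sum of the two bounds.\<close>
  then have "\<eta> * (norm x0)\<^sup>2 \<le> norm ?w * ?m" "\<nu> * (1 \<bullet> x0)\<^sup>2 \<le> norm ?w * ?m"
    by (auto intro!: mult_mono)
  then show "1 / 2 * (\<eta> * (norm x0)\<^sup>2 + \<nu> * (1 \<bullet> x0)\<^sup>2) \<le> norm ?w * ?m"
    by simp
qed

end
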